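(* Let $\psi$ be an $\mathrm{FO}^3(<,\mathrm{succ},\mathrm{min},\mathrm{max})$-formula, let $A$ and $B$ be sets of interpretations such that every interpretation in $A$ satisfies $\psi$ and every interpretation in $B$ satisfies $\neg\psi$, and let $\delta$ be a minimal separator for $\langle A,B\rangle$. Then $|\psi|\ge \tfrac12\, w(\delta)$.
   Context: For $N\in\mathbb{N}$, $\mathcal{A}_N$ is the structure with universe $\{0,\dots,N\}$, $<$ the natural order, $\mathrm{succ}=\{(a,a+1)\}$, $\mathrm{min}=0$, $\mathrm{max}=N$. $\mathrm{FO}^3(<,\mathrm{succ},\mathrm{min},\mathrm{max})$ consists of first-order formulas over this signature using only the variables $x,y,z$ (built from atoms $R(u,u')$ with $R\in\{<,=,\mathrm{succ}\}$, $u,u'\in\{\mathrm{min},\mathrm{max},x,y,z\}$ by $\neg,\vee,\wedge,\exists,\forall$). The size $|\psi|$ is the number of nodes of the syntax tree. An interpretation is a pair $(\mathcal{A},\alpha)$ with $\mathcal{A}=\mathcal{A}_N$ for some $N$ and $\alpha\colon\{x,y,z\}\to\{0,\dots,N\}$, extended by $\alpha(\mathrm{min})=0$, $\alpha(\mathrm{max})=N$. Let $\mathrm{diff}(m,n)=m-n$ and $<\!\text{-type}(m,n)\in\{<,=,>\}$ be the order relation between $m$ and $n$. Let $\mathcal{P}_2(S)$ be the set of 2-element subsets of $S$. A potential separator is a map $\delta\colon\mathcal{P}_2(\{\mathrm{min},\mathrm{max},x,y,z\})\to\mathbb{N}$. It is a separator for $\langle A,B\rangle$ if for every $(\mathcal{A},\alpha)\in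 A$ and $(\mathcal{B},\beta)\in B$ there are distinct $u,u'\in\{\mathrm{min},\mathrm{max},x,y,z\}$ with $\delta(\{u,u'\})\ge1$ and either (1) $<\!\text{-type}(\alpha(u),\alpha(u'))\ne<\!\text{-type}(\beta(u),\beta(u'))$, or (2) $\delta(\{u,u'\})\ge\min\{|\mathrm{diff}(\alpha(u),\alpha(u'))|,|\mathrm{diff}(\beta(u),\beta(u'))|\}$ and $\mathrm{diff}(\alpha(u),\alpha(u'))\ne\mathrm{diff}(\beta(u),\beta(u'))$. Define $b(\delta)=\max\{\delta(\{\mathrm{min},\mathrm{max}\}),\ \delta(\{\mathrm{min},u\})+\delta(\{u',\mathrm{max}\}) : u,u'\in\{x,y,z\}\}$, $c(\delta)=\max\{\delta(p)+\delta(q): p,q\in\mathcal{P}_2(\{x,y,z\}), p\ne q\}$, and the weight $w(\delta)=\sqrt{c(\delta)^2+b(\delta)}$. A minimal separator for $\langle A,B\rangle$ is a separator for $\langle A,B\rangle$ whose weight is minimal among all separators for $\langle A,B\rangle$. *)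

theory Defs
  imports Complex_Main "HOL-Library.Ramsey"
begin

datatype var = X | Y | Z

datatype fo_term = MinC | MaxC | Var var

datatype relsym = Less | Equal | Succ

datatype fo3 =
    Atom relsym fo_term fo_term
  | Neg fo3
  | Or fo3 fo3
  | And fo3 fo3
  | Exists var fo3
  | Forall var fo3

text \<open>The number of nodes of the syntax tree, whose leaves are the atomic formulas.\<close>

primrec fsize :: "fo3 \<Rightarrow> nat" where
  "fsize (Atom R u u') = 1"
| "fsize (Neg \<phi>) = fsize \<phi> + 1"
| "fsize (Or \<phi> \<psi>) = fsize \<phi> + fsize \<psi> + 1"
| "fsize (And \<phi> \<psi>) = fsize \<phi> + fsize \<psi> + 1"
| "fsize (Exists v \<phi>) = fsize \<phi> + 1"
| "fsize (Forall v \<phi>) = fsize \<phi> + 1"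

text \<open>
  The linear order with universe \<open>{0..N}\<close> is represented by \<open>N\<close>, so an interpretation
  is a pair \<open>(N, \<alpha>)\<close> where the assignment \<open>\<alpha>\<close> takes values in the universe.
\<close>

definition universe :: "nat \<Rightarrow> nat set" where
  "universe N = {0..N}"

fun rel_of :: "nat \<Rightarrow> relsym \<Rightarrow> (nat \<times> nat) set" where
  "rel_of N Less = {(a, b). a \<in> universe N \<and> b \<in> universe N \<and> a < b}"
| "rel_of N Equal = {(a, b). a \<in> universe N \<and> b \<in> universe N \<and> a = b}"
| "rel_of N Succ = {(a, b). a \<in> universe N \<and> b \<in> universe N \<and> b = a + 1}"

type_synonym interp = "nat \<times> (var \<Rightarrow> nat)"

definition interpretations :: "interp set" where
  "interpretations = {(N, \<alpha>). \<forall>v. \<alpha> v \<in> universe N}"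

fun val :: "interp \<Rightarrow> fo_term \<Rightarrow> nat" where
  "val (N, \<alpha>) MinC = 0"
| "val (N, \<alpha>) MaxC = N"
| "val (N, \<alpha>) (Var v) = \<alpha> v"

fun sat :: "interp \<Rightarrow> fo3 \<Rightarrow> bool" where
  "sat (N, \<alpha>) (Atom R u u') \<longleftrightarrow> (val (N, \<alpha>) u, val (N, \<alpha>) u') \<in> rel_of N R"
| "sat (N, \<alpha>) (Neg \<phi>) \<longleftrightarrow> \<not> sat (N, \<alpha>) \<phi>"
| "sat (N, \<alpha>) (Or \<phi> \<psi>) \<longleftrightarrow> sat (N, \<alpha>) \<phi> \<or> sat (N, \<alpha>) \<psi>"
| "sat (N, \<alpha>) (And \<phi> \<psi>) \<longleftrightarrow> sat (N, \<alpha>) \<phi> \<and> sat (N, \<alpha>) \<psi>"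
| "sat (N, \<alpha>) (Exists v \<phi>) \<longleftrightarrow> (\<exists>a \<in> universe N. sat (N, \<alpha>(v := a)) \<phi>)"
| "sat (N, \<alpha>) (Forall v \<phi>) \<longleftrightarrow> (\<forall>a \<in> universe N. sat (N, \<alpha>(v := a)) \<phi>)"

definition diff :: "nat \<Rightarrow> nat \<Rightarrow> int" where
  "diff m n = int m - int n"

datatype order_type = LT | EQ | GT

definition lt_type :: "nat \<Rightarrow> nat \<Rightarrow> order_type" where
  "lt_type m n = (if m < n then LT else if m = n then EQ else GT)"

text \<open>
  A potential separator is a map from the two-element sets of terms to the naturals. It is
  represented by a total function on sets of terms; all notions below consult it on
  two-element sets only.
\<close>

type_synonym potential_separator = "fo_term set \<Rightarrow> nat"

definition separator :: "interp set \<Rightarrow> interp set \<Rightarrow> potential_separator \<Rightarrow> bool" where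
  "separator A B \<delta> \<longleftrightarrow>
    (\<forall>I \<in> A. \<forall>J \<in> B. \<exists>u u'. u \<noteq> u' \<and> \<delta> {u, u'} \<ge> 1 \<and>
      (lt_type (val I u) (val I u') \<noteq> lt_type (val J u) (val J u') \<or>
       (int (\<delta> {u, u'}) \<ge> min \<bar>diff (val I u) (val I u')\<bar> \<bar>diff (val J u) (val J u')\<bar> \<and>
        diff (val I u) (val I u') \<noteq> diff (val J u) (val J u'))))"

definition border_distance :: "potential_separator \<Rightarrow> nat" where
  "border_distance \<delta> =
    Max ({\<delta> {MinC, MaxC}} \<union> {\<delta> {MinC, Var u} + \<delta> {Var u', MaxC} | u u'. True})"

lemma UNIV_var: "(UNIV :: var set) = {X, Y, Z}"
  using var.exhaust by auto

lemma finite_border: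
  "finite ({\<delta> {MinC, MaxC}} \<union> {\<delta> {MinC, Var u} + \<delta> {Var u', MaxC} | u u'. True})"
proof -
  have "{\<delta> {MinC, Var u} + \<delta> {Var u', MaxC} | u u'. True} =
      (\<lambda>(u, u'). \<delta> {MinC, Var u} + \<delta> {Var u', MaxC}) ` (UNIV \<times> UNIV)"
    by auto
  then show ?thesis by (simp add: UNIV_var del: UNIV_Times_UNIV)
qed

definition centre_distance :: "potential_separator \<Rightarrow> nat" where
  "centre_distance \<delta> =
    Max {\<delta> p + \<delta> q | p q. p \<in> [range Var]\<^bsup>2\<^esup> \<and> q \<in> [range Var]\<^bsup>2\<^esup> \<and> p \<noteq> q}"

lemma finite_centre:
  "finite {\<delta> p + \<delta> q | p q. p \<in> [range Var]\<^bsup>2\<^esup> \<and> q \<in> [range Var]\<^bsup>2\<^esup> \<and> p \<noteq> q}"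
proof (rule finite_subset)
  show "{\<delta> p + \<delta> q | p q. p \<in> [range Var]\<^bsup>2\<^esup> \<and> q \<in> [range Var]\<^bsup>2\<^esup> \<and> p \<noteq> q} \<subseteq>
      (\<lambda>(p, q). \<delta> p + \<delta> q) ` ([range Var]\<^bsup>2\<^esup> \<times> [range Var]\<^bsup>2\<^esup>)"
    by auto
  show "finite ((\<lambda>(p, q). \<delta> p + \<delta> q) ` ([range Var]\<^bsup>2\<^esup> \<times> [range Var]\<^bsup>2\<^esup>))"
    by (simp add: UNIV_var finite_imp_finite_nsets)
qed

lemma nonempty_centre:
  "{\<delta> p + \<delta> q | p q. p \<in> [range Var]\<^bsup>2\<^esup> \<and> q \<in> [range Var]\<^bsup>2\<^esup> \<and> p \<noteq> q} \<noteq> {}"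
proof -
  have "{Var X, Var Y} \<in> [range Var]\<^bsup>2\<^esup>" "{Var X, Var Z} \<in> [range Var]\<^bsup>2\<^esup>"
       "{Var X, Var Y} \<noteq> {Var X, Var Z}"
    by (auto simp: nsets_def doubleton_eq_iff)
  then show ?thesis by blast
qed

definition weight :: "potential_separator \<Rightarrow> real" where
  "weight \<delta> = sqrt (real ((centre_distance \<delta>)\<^sup>2 + border_distance \<delta>))"

definition minimal_separator :: "interp set \<Rightarrow> interp set \<Rightarrow> potential_separator \<Rightarrow> bool" where
  "minimal_separator A B \<delta> \<longleftrightarrow>
    separator A B \<delta> \<and> (\<forall>\<delta>'. separator A B \<delta>' \<longrightarrow> weight \<delta> \<le> weight \<delta>')"

end

theory Submission
  imports Defs
begin

text \<open>
  Call two interpretations indistinguishable for \<open>\<delta>\<close> if no pair of terms separates them. By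
  induction on \<open>\<psi>\<close> there is a \<open>\<delta>\<close> of weight at most \<open>2|\<psi>|\<close> whose indistinguishability relation
  preserves \<open>\<psi>\<close>; such a \<open>\<delta>\<close> separates \<open>A\<close> from \<open>B\<close>, so it bounds the minimal weight. Binary
  connectives take the pointwise maximum, and \<open>(c\<^sub>1 + c\<^sub>2)\<^sup>2 + b\<^sub>1 + b\<^sub>2 \<le> (w\<^sub>1 + w\<^sub>2)\<^sup>2\<close>. A
  quantifier over \<open>v\<close> replaces \<open>\<delta> {t, t'}\<close> by at least \<open>\<delta> {v, t} + \<delta> {v, t'} + 1\<close>: to answer a
  move of \<open>v\<close>, each term \<open>t\<close> confines the reply to an interval, these intervals intersect pairwise
  and hence (Helly in dimension one) have a common point. This raises \<open>c\<close> by at most \<open>1\<close> and \<open>b\<close>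
  by at most \<open>2c + 2\<close>, hence the weight by at most \<open>2\<close>.
\<close>

section \<open>Indistinguishability up to thresholds\<close>

definition agree_upto :: "nat \<Rightarrow> int \<Rightarrow> int \<Rightarrow> bool" where
  "agree_upto d i j \<longleftrightarrow> i = j \<or> (i > int d \<and> j > int d) \<or> (i < - int d \<and> j < - int d)"

definition indist :: "potential_separator \<Rightarrow> interp \<Rightarrow> interp \<Rightarrow> bool" where
  "indist \<delta> I J \<longleftrightarrow> (\<forall>u u'. u \<noteq> u' \<longrightarrow> \<delta> {u, u'} \<ge> 1 \<longrightarrow>
     agree_upto (\<delta> {u, u'}) (diff (val I u) (val I u')) (diff (val J u) (val J u')))"

lemma indistD:
  assumes "indist \<delta> I J" "u \<noteq> u'" "\<delta> {u, u'} \<ge> 1"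
  shows "agree_upto (\<delta> {u, u'}) (diff (val I u) (val I u')) (diff (val J u) (val J u'))"
  using assms by (auto simp: indist_def)

lemma agree_upto_mono: "agree_upto d' i j \<Longrightarrow> d \<le> d' \<Longrightarrow> agree_upto d i j"
  by (auto simp: agree_upto_def)

lemma agree_upto_sym: "agree_upto d i j \<Longrightarrow> agree_upto d j i"
  by (auto simp: agree_upto_def)

lemma indist_mono:
  assumes "indist \<delta>' I J" "\<And>p. \<delta> p \<le> \<delta>' p"
  shows "indist \<delta> I J"
  using assms unfolding indist_def by (meson agree_upto_mono le_trans)

text \<open>For a threshold \<open>d\<close> the separation clauses fail at two differences exactly
  when these have the same sign and are either equal or both larger than \<open>d\<close> in
  absolute value. This is \<open>agree_upto d\<close>, so \<open>indist\<close> says that every pair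
  of terms fails to separate.\<close>

lemma not_indist_imp_separator:
  assumes "\<And>I J. I \<in> A \<Longrightarrow> J \<in> B \<Longrightarrow> \<not> indist \<delta> I J"
  shows "separator A B \<delta>"
  unfolding separator_def
proof (intro ballI)
  fix I J assume "I \<in> A" "J \<in> B"
  then obtain u u' where "u \<noteq> u'" "\<delta> {u, u'} \<ge> 1"
    "\<not> agree_upto (\<delta> {u, u'}) (diff (val I u) (val I u')) (diff (val J u) (val J u'))"
    using assms unfolding indist_def by blast
  moreover from this(3) have "lt_type (val I u) (val I u') \<noteq> lt_type (val J u) (val J u') \<or>
       (int (\<delta> {u, u'}) \<ge> min \<bar>diff (val I u) (val I u')\<bar> \<bar>diff (val J u) (val J u')\<bar> \<and>
        diff (val I u) (val I u') \<noteq> diff (val J u) (val J u'))"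
    by (auto simp: agree_upto_def lt_type_def diff_def min_def split: if_splits)
  ultimately show "\<exists>u u'. u \<noteq> u' \<and> \<delta> {u, u'} \<ge> 1 \<and>
      (lt_type (val I u) (val I u') \<noteq> lt_type (val J u) (val J u') \<or>
       (int (\<delta> {u, u'}) \<ge> min \<bar>diff (val I u) (val I u')\<bar> \<bar>diff (val J u) (val J u')\<bar> \<and>
        diff (val I u) (val I u') \<noteq> diff (val J u) (val J u')))"
    by blast
qed

section \<open>Estimates for the weight\<close>

lemma border_ge:
  shows "\<delta> {MinC, MaxC} \<le> border_distance \<delta>"
    and "\<delta> {MinC, Var u} + \<delta> {Var u', MaxC} \<le> border_distance \<delta>"
  unfolding border_distance_def by (rule Max_ge[OF finite_border]; blast)+

lemma border_le:
  assumes "\<delta> {MinC, MaxC} \<le> k" "\<And>u u'. \<delta> {MinC, Var u} + \<delta> {Var u', MaxC} \<le> k"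
  shows "border_distance \<delta> \<le> k"
  unfolding border_distance_def using assms by (subst Max_le_iff[OF finite_border]) auto

lemma centre_ge:
  assumes "u \<noteq> u'" "w \<noteq> w'" "{u, u'} \<noteq> {w, w'}"
  shows "\<delta> {Var u, Var u'} + \<delta> {Var w, Var w'} \<le> centre_distance \<delta>"
  unfolding centre_distance_def
proof (rule Max_ge[OF finite_centre], rule CollectI, intro exI conjI)
  show "{Var u, Var u'} \<noteq> {Var w, Var w'}"
    using assms by (auto simp: doubleton_eq_iff)
qed (use assms in \<open>auto simp: nsets_def\<close>)

lemma centre_le:
  assumes "\<And>u u' w w'. u \<noteq> u' \<Longrightarrow> w \<noteq> w' \<Longrightarrow> {u, u'} \<noteq> {w, w'} \<Longrightarrow>
     \<delta> {Var u, Var u'} + \<delta> {Var w, Var w'} \<le> k"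
  shows "centre_distance \<delta> \<le> k"
  unfolding centre_distance_def
proof (subst Max_le_iff[OF finite_centre nonempty_centre], rule ballI)
  fix s assume "s \<in> {\<delta> p + \<delta> q | p q. p \<in> [range Var]\<^bsup>2\<^esup> \<and> q \<in> [range Var]\<^bsup>2\<^esup> \<and> p \<noteq> q}"
  then obtain p q where s: "s = \<delta> p + \<delta> q" "p \<noteq> q"
    and p: "p \<subseteq> range Var" "card p = 2" and q: "q \<subseteq> range Var" "card q = 2"
    by (auto simp: nsets_def)
  have doubleton: "\<exists>u u'. r = {Var u, Var u'} \<and> u \<noteq> u'"
    if r: "r \<subseteq> range Var" "card r = 2" for r
  proof -
    obtain t t' where "r = {t, t'}" "t \<noteq> t'" using r(2) by (auto simp: card_2_iff)
    moreover from this r(1) obtain u u' where "t = Var u" "t' = Var u'" by auto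
    ultimately show ?thesis by auto
  qed
  obtain u u' where "p = {Var u, Var u'}" "u \<noteq> u'"
    using doubleton[OF p] by blast
  moreover obtain w w' where "q = {Var w, Var w'}" "w \<noteq> w'"
    using doubleton[OF q] by blast
  moreover from calculation have "{u, u'} \<noteq> {w, w'}"
    using s(2) by (auto simp: doubleton_eq_iff)
  ultimately show "s \<le> k" using s(1) assms[of u u' w w'] by simp
qed

lemma weight_nonneg: "0 \<le> weight \<delta>"
  by (simp add: weight_def)

lemma weight_square:
  "(weight \<delta>)\<^sup>2 = (real (centre_distance \<delta>))\<^sup>2 + real (border_distance \<delta>)"
  by (simp add: weight_def)

lemma centre_le_weight: "real (centre_distance \<delta>) \<le> weight \<delta>"
  unfolding weight_def by (rule real_le_rsqrt) simp

lemma weight_leI: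
  assumes "(real (centre_distance \<delta>))\<^sup>2 + real (border_distance \<delta>) \<le> r\<^sup>2" "0 \<le> r"
  shows "weight \<delta> \<le> r"
  using assms by (metis power2_le_imp_le weight_square)

lemma weight_single: "weight (\<lambda>p. if p = {t, t'} then 1 else 0) \<le> 2"
proof -
  let ?\<delta> = "\<lambda>p. if p = {t, t'} then 1 else 0 :: nat"
  \<comment> \<open>Two different pairs cannot both equal \<open>{t, t'}\<close>, so the centre sum
    is at most 1; in total 1 + 2 stays below the square of 2.\<close>
  have "centre_distance ?\<delta> \<le> 1"
    by (rule centre_le) (auto simp: doubleton_eq_iff)
  moreover have "border_distance ?\<delta> \<le> 2"
    by (rule border_le) auto
  ultimately have "(real (centre_distance ?\<delta>))\<^sup>2 + real (border_distance ?\<delta>) \<le> 1\<^sup>2 + 2"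
    by (intro add_mono power_mono) auto
  then show ?thesis by (intro weight_leI) auto
qed

lemma weight_max: "weight (\<lambda>p. max (\<delta>1 p) (\<delta>2 p)) \<le> weight \<delta>1 + weight \<delta>2"
proof -
  let ?\<delta> = "\<lambda>p. max (\<delta>1 p) (\<delta>2 p)"
  have c: "centre_distance ?\<delta> \<le> centre_distance \<delta>1 + centre_distance \<delta>2"
  proof (rule centre_le)
    fix u u' w w' :: var
    assume "u \<noteq> u'" "w \<noteq> w'" "{u, u'} \<noteq> {w, w'}"
    from centre_ge[OF this, of \<delta>1] centre_ge[OF this, of \<delta>2]
    show "?\<delta> {Var u, Var u'} + ?\<delta> {Var w, Var w'} \<le> centre_distance \<delta>1 + centre_distance \<delta>2"
      by linarith
  qed
  have b: "border_distance ?\<delta> \<le> border_distance \<delta>1 + border_distance \<delta>2"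
  proof (rule border_le)
    show "?\<delta> {MinC, MaxC} \<le> border_distance \<delta>1 + border_distance \<delta>2"
      using border_ge(1)[of \<delta>1] border_ge(1)[of \<delta>2] by linarith
    show "?\<delta> {MinC, Var u} + ?\<delta> {Var u', MaxC} \<le> border_distance \<delta>1 + border_distance \<delta>2"
      for u u'
      using border_ge(2)[of \<delta>1 u u'] border_ge(2)[of \<delta>2 u u'] by linarith
  qed
  let ?c1 = "real (centre_distance \<delta>1)" and ?c2 = "real (centre_distance \<delta>2)"
  have "(real (centre_distance ?\<delta>))\<^sup>2 \<le> (?c1 + ?c2)\<^sup>2"
    using c by (intro power_mono) auto
  \<comment> \<open>The cross term of the squared sum of centres is absorbed by the cross term of
    the squared sum of weights.\<close>
  moreover have "?c1 * ?c2 \<le> weight \<delta>1 * weight \<delta>2"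
    by (intro mult_mono centre_le_weight weight_nonneg) auto
  ultimately show ?thesis
    using b weight_square[of \<delta>1] weight_square[of \<delta>2] weight_nonneg
    by (intro weight_leI) (auto simp: power2_sum)
qed

text \<open>Pairs containing \<open>v\<close> get 0 because the quantifier forgets the old value of
  \<open>v\<close>. For other pairs the sum is the combined range in which the new \<open>v\<close>
  is compared with both terms; the extra 1 leaves room for a \<open>v\<close> lying between them
  beyond both thresholds.\<close>

definition quantifier_separator :: "var \<Rightarrow> potential_separator \<Rightarrow> potential_separator" where
  "quantifier_separator v \<delta> p =
     (if Var v \<in> p then 0 else max (\<delta> p) (1 + (\<Sum>t\<in>p. \<delta> {Var v, t})))"

lemma weight_quantifier_separator:
  "weight (quantifier_separator v \<delta>) \<le> weight \<delta> + 2"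
proof -
  let ?\<delta> = "quantifier_separator v \<delta>" and ?e = "\<lambda>t. \<delta> {Var v, t}"
  have c: "centre_distance ?\<delta> \<le> centre_distance \<delta> + 1"
  proof (rule centre_le)
    fix u u' w w' :: var
    assume *: "u \<noteq> u'" "w \<noteq> w'" "{u, u'} \<noteq> {w, w'}"
    have e: "?e (Var s) + ?e (Var s') \<le> centre_distance \<delta>" if "s \<noteq> s'" "v \<noteq> s" "v \<noteq> s'" for s s'
      using that by (intro centre_ge) (auto simp: doubleton_eq_iff)
    \<comment> \<open>Of the three pairs of variables only one avoids \<open>v\<close>. Hence one of
      the two summands vanishes, and the other is bounded by \<open>c\<close> or by
      \<open>c + 1\<close>.\<close>
    have "v \<in> {u, u'} \<or> v \<in> {w, w'}"
      using * by (cases v; cases u; cases u'; cases w; cases w'; simp add: doubleton_eq_iff)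
    then show "?\<delta> {Var u, Var u'} + ?\<delta> {Var w, Var w'} \<le> centre_distance \<delta> + 1"
      using centre_ge[OF *, of \<delta>] e[of u u'] e[of w w'] *
      by (auto simp: quantifier_separator_def)
  qed
  have b: "border_distance ?\<delta> \<le> border_distance \<delta> + 2 * centre_distance \<delta> + 2"
  proof (rule border_le)
    show "?\<delta> {MinC, MaxC} \<le> border_distance \<delta> + 2 * centre_distance \<delta> + 2"
      using border_ge(1)[of \<delta>] border_ge(2)[of \<delta> v v]
      by (auto simp: quantifier_separator_def insert_commute)
    fix u u'
    have e: "?e (Var s) \<le> centre_distance \<delta>" if "v \<noteq> s" for s
    proof -
      \<comment> \<open>The centre distance only sees sums over two different pairs; the third
        variable \<open>r\<close> supplies the second pair.\<close>
      obtain r where "r \<noteq> v" "r \<noteq> s" by (cases v; cases s) auto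
      then show ?thesis using centre_ge[of v s v r \<delta>] that by (auto simp: doubleton_eq_iff)
    qed
    \<comment> \<open>Each summand is 0, its old value, or one plus a border value at
      \<open>v\<close> plus some \<open>?e\<close> of a variable, which is at most \<open>c\<close>.
      The four instances of \<open>border_ge(2)\<close> cover the combinations.\<close>
    show "?\<delta> {MinC, Var u} + ?\<delta> {Var u', MaxC} \<le> border_distance \<delta> + 2 * centre_distance \<delta> + 2"
      using border_ge(2)[of \<delta> v v] border_ge(2)[of \<delta> u u'] border_ge(2)[of \<delta> u v]
        border_ge(2)[of \<delta> v u'] e[of u] e[of u']
      by (auto simp: quantifier_separator_def insert_commute)
  qed
  let ?c = "real (centre_distance \<delta>)"
  \<comment> \<open>The total is at most \<open>c^2 + b + 4 * c + 3\<close>, which is below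
    \<open>(w + 2)^2\<close> because \<open>c \<le> w\<close>.\<close>
  have "(real (centre_distance ?\<delta>))\<^sup>2 \<le> (?c + 1)\<^sup>2"
    using c by (intro power_mono) auto
  then show ?thesis
    using b weight_square[of \<delta>] weight_nonneg[of \<delta>] centre_le_weight[of \<delta>]
    by (intro weight_leI) (auto simp: power2_sum)
qed

section \<open>Answering a quantifier move\<close>

lemma intervals_common_point:
  fixes L U :: "'a \<Rightarrow> int"
  assumes "finite T" "T \<noteq> {}" "\<And>t t'. t \<in> T \<Longrightarrow> t' \<in> T \<Longrightarrow> L t \<le> U t'"
  obtains b where "\<And>t. t \<in> T \<Longrightarrow> L t \<le> b \<and> b \<le> U t"
proof
  show "L t \<le> Max (L ` T) \<and> Max (L ` T) \<le> U t" if "t \<in> T" for t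
    using that assms by auto
qed

lemma UNIV_fo_term: "(UNIV :: fo_term set) = {MinC, MaxC, Var X, Var Y, Var Z}"
proof -
  have "t \<in> {MinC, MaxC, Var X, Var Y, Var Z}" for t
  proof (cases t)
    case (Var v)
    then show ?thesis by (cases v) auto
  qed auto
  then show ?thesis by blast
qed

lemma finite_fo_terms [simp]: "finite (S :: fo_term set)"
  by (rule finite_subset[OF subset_UNIV]) (simp add: UNIV_fo_term)

lemma val_update: "val (N, \<alpha>(v := a)) t = (if t = Var v then a else val (N, \<alpha>) t)"
  by (cases t) auto

text \<open>This is one round of an Ehrenfeucht-Fraisse game: each term other than \<open>v\<close>
  restricts the reply to an interval, and any common point of these intervals is a good
  reply.\<close>

lemma indist_extend:
  assumes ind: "indist (quantifier_separator v \<delta>) (N, \<alpha>) (M, \<beta>)" and a: "a \<le> N"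
  obtains b where "b \<le> M" "indist \<delta> (N, \<alpha>(v := a)) (M, \<beta>(v := b))"
proof -
  define e where "e t = \<delta> {Var v, t}" for t
  define i where "i t = int (val (N, \<alpha>) t)" for t
  define j where "j t = int (val (M, \<beta>) t)" for t
  \<comment> \<open>The offset \<open>s t\<close> of the move from \<open>t\<close> must be copied
    exactly within \<open>e t\<close>. Beyond that, one end of the interval sits at distance
    \<open>e t + 1\<close> from \<open>j t\<close>, and the other is the default 0 or
    \<open>M\<close>; for \<open>e t = 0\<close> both ends are defaults.\<close>
  define s where "s t = int a - i t" for t
  define T where "T = - {Var v}"
  define L where "L t = (if e t \<ge> 1 \<and> s t \<ge> - int (e t)
      then j t + min (s t) (int (e t) + 1) else 0)" for t
  define U where "U t = (if e t \<ge> 1 \<and> s t \<le> int (e t)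
      then j t + max (s t) (- int (e t) - 1) else int M)" for t
  have ends: "i MinC = 0" "j MinC = 0" "i MaxC = int N" "j MaxC = int M"
    by (auto simp: i_def j_def)
  have nonneg: "i t \<ge> 0" "j t \<ge> 0" for t
    by (auto simp: i_def j_def)
  have agree: "agree_upto (e t + e t' + 1) (i t - i t') (j t - j t')"
    and agree': "agree_upto (\<delta> {t, t'}) (i t - i t') (j t - j t')"
    if "t \<in> T" "t' \<in> T" "t \<noteq> t'" for t t'
  proof -
    have "quantifier_separator v \<delta> {t, t'} = max (\<delta> {t, t'}) (e t + e t' + 1)"
      using that by (auto simp: quantifier_separator_def T_def e_def)
    moreover from this have "agree_upto (quantifier_separator v \<delta> {t, t'}) (i t - i t') (j t - j t')"
      using indistD[OF ind, of t t'] that by (simp add: i_def j_def diff_def)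
    ultimately show "agree_upto (e t + e t' + 1) (i t - i t') (j t - j t')"
      "agree_upto (\<delta> {t, t'}) (i t - i t') (j t - j t')"
      by (auto elim: agree_upto_mono)
  qed
  have MT: "MinC \<in> T" "MaxC \<in> T" by (auto simp: T_def)
  \<comment> \<open>Comparison with \<open>MaxC\<close> here, and with \<open>MinC\<close> for
    \<open>ZU\<close>, makes the intervals compatible with the default ends.\<close>
  have LM: "L t \<le> int M" if t: "t \<in> T" for t
  proof (cases "t = MaxC")
    case True
    then show ?thesis using a by (auto simp: L_def s_def ends)
  next
    case False
    show ?thesis
      using agree[OF MT(2) t] False a by (auto simp: L_def s_def ends agree_upto_def)
  qed
  have ZU: "0 \<le> U t" if t: "t \<in> T" for t
  proof (cases "t = MinC")
    case True
    then show ?thesis by (auto simp: U_def s_def ends)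
  next
    case False
    show ?thesis
      using agree[OF t MT(1)] False nonneg[of t] by (auto simp: U_def s_def ends agree_upto_def)
  qed
  have LU: "L t \<le> U t'" if "t \<in> T" "t' \<in> T" for t t'
  proof (cases "t = t'")
    case True
    then show ?thesis using LM[of t] ZU[of t] that by (auto simp: L_def U_def split: if_splits)
  next
    case False
    \<comment> \<open>The tight case is \<open>s t > e t\<close> and \<open>s t' < - e t'\<close>.
      Then \<open>i t' - i t\<close> is at least \<open>e t + e t' + 2\<close>, just above the
      agreement threshold, so \<open>j t' - j t\<close> is equally large and leaves room for both
      bounds.\<close>
    show ?thesis
      using LM[of t] ZU[of t'] that agree[OF that False]
      by (auto simp: L_def U_def s_def agree_upto_def split: if_splits)
  qed
  obtain b where b: "\<And>t. t \<in> T \<Longrightarrow> L t \<le> b \<and> b \<le> U t"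
    using intervals_common_point[of T L U] LU MT by auto
  \<comment> \<open>The intervals of the two constants keep the reply inside the universe, so
    \<open>nat b\<close> loses nothing.\<close>
  have "0 \<le> L MinC" "U MaxC \<le> int M"
    using a by (auto simp: L_def U_def s_def ends)
  then have b0: "0 \<le> b" "b \<le> int M" using b[OF MT(1)] b[OF MT(2)] by auto
  have fresh: "agree_upto (e t) (int a - i t) (b - j t)" if "t \<in> T" "e t \<ge> 1" for t
    using b[OF that(1)] that(2) by (auto simp: L_def U_def s_def agree_upto_def split: if_splits)
  have "indist \<delta> (N, \<alpha>(v := a)) (M, \<beta>(v := nat b))"
    unfolding indist_def
  proof (intro allI impI)
    fix u u' :: fo_term
    assume uu: "u \<noteq> u'" "\<delta> {u, u'} \<ge> 1"
    consider "u = Var v" "u' \<in> T" | "u' = Var v" "u \<in> T" | "u \<in> T" "u' \<in> T"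
      using uu by (auto simp: T_def)
    then show "agree_upto (\<delta> {u, u'})
       (diff (val (N, \<alpha>(v := a)) u) (val (N, \<alpha>(v := a)) u'))
       (diff (val (M, \<beta>(v := nat b)) u) (val (M, \<beta>(v := nat b)) u'))"
    proof cases
      case 1
      then show ?thesis
        using fresh[of u'] uu b0 by (auto simp: val_update diff_def e_def i_def j_def)
    next
      case 2
      \<comment> \<open>With \<open>v\<close> in second place both differences change sign, which
        \<open>agree_upto\<close> respects.\<close>
      then have "agree_upto (\<delta> {u, u'}) (int a - i u) (b - j u)"
        using fresh[of u] uu by (simp add: e_def insert_commute)
      then show ?thesis
        using 2 uu b0 by (auto simp: val_update diff_def i_def j_def agree_upto_def)
    next
      case 3
      then show ?thesis
        using agree'[of u u'] uu by (auto simp: val_update diff_def i_def j_def T_def)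
    qed
  qed
  then show ?thesis using that[of "nat b"] b0 by auto
qed

section \<open>Preservation of formulas and the induction\<close>

definition preserves :: "potential_separator \<Rightarrow> fo3 \<Rightarrow> bool" where
  "preserves \<delta> \<psi> \<longleftrightarrow> (\<forall>I\<in>interpretations. \<forall>J\<in>interpretations.
     indist \<delta> I J \<longrightarrow> sat I \<psi> \<longrightarrow> sat J \<psi>)"

lemma indist_sym: "indist \<delta> I J \<Longrightarrow> indist \<delta> J I"
  unfolding indist_def using agree_upto_sym by blast

lemma sat_connectives:
  "sat I (Neg \<phi>) \<longleftrightarrow> \<not> sat I \<phi>"
  "sat I (Or \<phi> \<psi>) \<longleftrightarrow> sat I \<phi> \<or> sat I \<psi>"
  "sat I (And \<phi> \<psi>) \<longleftrightarrow> sat I \<phi> \<and> sat I \<psi>"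
  by (cases I; simp)+

text \<open>By contraposition with the two interpretations exchanged, as indistinguishability is
  symmetric.\<close>

lemma preserves_Neg: "preserves \<delta> \<psi> \<Longrightarrow> preserves \<delta> (Neg \<psi>)"
  unfolding preserves_def sat_connectives using indist_sym by blast

lemma preserves_max:
  assumes "preserves \<delta>1 \<phi>" "preserves \<delta>2 \<psi>"
  shows "preserves (\<lambda>p. max (\<delta>1 p) (\<delta>2 p)) (Or \<phi> \<psi>)"
    and "preserves (\<lambda>p. max (\<delta>1 p) (\<delta>2 p)) (And \<phi> \<psi>)"
proof -
  have "indist \<delta>1 I J" "indist \<delta>2 I J" if "indist (\<lambda>p. max (\<delta>1 p) (\<delta>2 p)) I J" for I J
    using indist_mono[OF that] by auto
  then show "preserves (\<lambda>p. max (\<delta>1 p) (\<delta>2 p)) (Or \<phi> \<psi>)"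
    "preserves (\<lambda>p. max (\<delta>1 p) (\<delta>2 p)) (And \<phi> \<psi>)"
    using assms unfolding preserves_def sat_connectives by blast+
qed

lemma preserves_Exists:
  assumes "preserves \<delta> \<psi>"
  shows "preserves (quantifier_separator v \<delta>) (Exists v \<psi>)"
  unfolding preserves_def
proof (clarify)
  fix N \<alpha> M \<beta>
  assume I: "(N, \<alpha>) \<in> interpretations" and J: "(M, \<beta>) \<in> interpretations"
    and ind: "indist (quantifier_separator v \<delta>) (N, \<alpha>) (M, \<beta>)"
    and "sat (N, \<alpha>) (Exists v \<psi>)"
  then obtain a where a: "a \<le> N" "sat (N, \<alpha>(v := a)) \<psi>" by (auto simp: universe_def)
  obtain b where b: "b \<le> M" "indist \<delta> (N, \<alpha>(v := a)) (M, \<beta>(v := b))"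
    using indist_extend[OF ind a(1)] .
  have "(N, \<alpha>(v := a)) \<in> interpretations" "(M, \<beta>(v := b)) \<in> interpretations"
    using I J a b by (auto simp: interpretations_def universe_def)
  then have "sat (M, \<beta>(v := b)) \<psi>"
    using assms a b unfolding preserves_def by blast
  then show "sat (M, \<beta>) (Exists v \<psi>)" using b by (auto simp: universe_def)
qed

lemma preserves_Forall:
  assumes "preserves \<delta> \<psi>"
  shows "preserves (quantifier_separator v \<delta>) (Forall v \<psi>)"
proof -
  have "sat I (Forall v \<psi>) \<longleftrightarrow> sat I (Neg (Exists v (Neg \<psi>)))" for I
    by (cases I) simp
  then show ?thesis
    using preserves_Neg[OF preserves_Exists[OF preserves_Neg[OF assms], of v]]
    by (simp only: preserves_def)
qed

lemma val_in_universe: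
  assumes "(N, \<alpha>) \<in> interpretations"
  shows "val (N, \<alpha>) t \<in> universe N"
  using assms by (cases t) (auto simp: interpretations_def universe_def)

text \<open>Threshold 1 determines whether a difference is -1, 0 or 1 and otherwise its sign, which
  decides all three relations.\<close>

lemma preserves_Atom: "preserves (\<lambda>p. if p = {u, u'} then 1 else 0) (Atom R u u')"
  unfolding preserves_def
proof (clarify)
  fix N \<alpha> M \<beta>
  assume I: "(N, \<alpha>) \<in> interpretations" and J: "(M, \<beta>) \<in> interpretations"
    and ind: "indist (\<lambda>p. if p = {u, u'} then 1 else 0) (N, \<alpha>) (M, \<beta>)"
    and sat: "sat (N, \<alpha>) (Atom R u u')"
  show "sat (M, \<beta>) (Atom R u u')"
  \<comment> \<open>For equal terms the truth value of the atom depends only on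
    \<open>R\<close>.\<close>
  proof (cases "u = u'")
    case True
    then show ?thesis using sat val_in_universe[OF J, of u'] by (cases R) auto
  next
    case False
    then show ?thesis
      using indistD[OF ind False] sat val_in_universe[OF J, of u'] val_in_universe[OF J, of u]
      by (cases R) (auto simp: agree_upto_def diff_def)
  qed
qed

text \<open>Each node has a budget of 2: atoms and quantifiers may spend it fully, negation keeps
  the separator, and binary connectives at most add the weights of their parts.\<close>

lemma ex_preserving_separator: "\<exists>\<delta>. preserves \<delta> \<psi> \<and> weight \<delta> \<le> 2 * real (fsize \<psi>)"
proof (induction \<psi>)
  case (Atom R u u')
  then show ?case using preserves_Atom[of u u' R] weight_single[of u u'] by force
next
  case (Neg \<psi>)
  then show ?case using preserves_Neg by force
next
  case (Or \<phi> \<psi>)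
  then obtain \<delta>1 \<delta>2 where "preserves \<delta>1 \<phi>" "weight \<delta>1 \<le> 2 * real (fsize \<phi>)"
    "preserves \<delta>2 \<psi>" "weight \<delta>2 \<le> 2 * real (fsize \<psi>)" by blast
  with preserves_max(1)[of \<delta>1 \<phi> \<delta>2 \<psi>] weight_max[of \<delta>1 \<delta>2] show ?case
    by (intro exI[of _ "\<lambda>p. max (\<delta>1 p) (\<delta>2 p)"]) simp
next
  case (And \<phi> \<psi>)
  then obtain \<delta>1 \<delta>2 where "preserves \<delta>1 \<phi>" "weight \<delta>1 \<le> 2 * real (fsize \<phi>)"
    "preserves \<delta>2 \<psi>" "weight \<delta>2 \<le> 2 * real (fsize \<psi>)" by blast
  with preserves_max(2)[of \<delta>1 \<phi> \<delta>2 \<psi>] weight_max[of \<delta>1 \<delta>2] show ?case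
    by (intro exI[of _ "\<lambda>p. max (\<delta>1 p) (\<delta>2 p)"]) simp
next
  case (Exists v \<psi>)
  then obtain \<delta> where "preserves \<delta> \<psi>" "weight \<delta> \<le> 2 * real (fsize \<psi>)" by blast
  with preserves_Exists[of \<delta> \<psi> v] weight_quantifier_separator[of v \<delta>] show ?case
    by (intro exI[of _ "quantifier_separator v \<delta>"]) simp
next
  case (Forall v \<psi>)
  then obtain \<delta> where "preserves \<delta> \<psi>" "weight \<delta> \<le> 2 * real (fsize \<psi>)" by blast
  with preserves_Forall[of \<delta> \<psi> v] weight_quantifier_separator[of v \<delta>] show ?case
    by (intro exI[of _ "quantifier_separator v \<delta>"]) simp
qed

theorem theorem3p6:
  fixes \<psi> :: fo3 and A B :: "interp set" and \<delta> :: potential_separator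
  assumes "A \<subseteq> interpretations" and "B \<subseteq> interpretations"
    and "\<And>I. I \<in> A \<Longrightarrow> sat I \<psi>"
    and "\<And>J. J \<in> B \<Longrightarrow> sat J (Neg \<psi>)"
    and "minimal_separator A B \<delta>"
  shows "real (fsize \<psi>) \<ge> 1 / 2 * weight \<delta>"
proof -
  \<comment> \<open>This separator is built from \<open>\<psi>\<close> alone and works for all
    \<open>A\<close> and \<open>B\<close> that \<open>\<psi>\<close> tells apart.\<close>
  obtain \<delta>' where \<delta>': "preserves \<delta>' \<psi>" "weight \<delta>' \<le> 2 * real (fsize \<psi>)"
    using ex_preserving_separator by blast
  have "separator A B \<delta>'"
  proof (rule not_indist_imp_separator)
    fix I J assume "I \<in> A" "J \<in> B"
    moreover from this have "\<not> sat J \<psi>" using assms(4)[of J] by (simp add: sat_connectives)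
    ultimately show "\<not> indist \<delta>' I J"
      using \<delta>'(1) assms(1-3) unfolding preserves_def by blast
  qed
  then have "weight \<delta> \<le> weight \<delta>'"
    using assms(5) unfolding minimal_separator_def by blast
  with \<delta>'(2) show ?thesis by simp
qed

end
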